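(* Let $g:\mathbb{N}\to\mathbb{Q}$ be a function. If $g$ is a piecewise quasi-polynomial whose range is contained in $\mathbb{N}$, then $g$ is a Presburger counting function.
   Context: Notation: $\mathbb{N}=\{0,1,2,\ldots\}$. A Presburger formula is a first-order formula in the language of addition, evaluated over the natural numbers $\mathbb{N}$ (all variables, free and quantified, range over $\mathbb{N}$). Equivalently, it is a Boolean combination of linear equalities and inequalities with integer coefficients and integer constant terms, with some of the variables quantified by $\exists$ or $\forall$ (nested arbitrarily). Given a Presburger formula $F(\mathbf{c},p)$ with free variables $\mathbf{c}=(c_1,\ldots,c_d)$ (counted variables) and $p$ (a single parameter variable), its Presburger counting function is $g_F(p)=\#\{\mathbf{c}\in\mathbb{N}^d : F(\mathbf{c},p)\}$. Only formulas for which $g_F(p)$ is finite for all $p\in\mathbb{N}$ are considered. A function $g$ is a Presburger counting function if $g=g_F$ for some such $F$ (with any number $d$ of counted variables). A quasi-polynomial (over $\mathbb{Q}$) in one variable is a function $g:\mathbb{N}\to\mathbb{Q}$ such that there exist a 1-dimensional lattice $\Lambda\subseteq\mathbb{Z}$ (i.e. $\Lambda=m\mathbb{Z}$ with $m\geq 1$) and polynomials $q_{\bar\lambda}(p)\in\mathbb{Q}[p]$, one for each coset $\bar\lambda\in\mathbb{Z}/\Lambda$, such that $g(p)=q_{\bar\lambda}(p)$ for all $p\in\bar\lambda\cap\mathbb{N}$. A piecewise quasi-polynomial in one variable is a function $g:\mathbb{N}\to\mathbb{Q}$ such that there exist a finite partition $\bigcup_i(P_i\cap\mathbb{N})$ of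 $\mathbb{N}$ with $P_i\subseteq\mathbb{R}$ polyhedra (solution sets of finitely many non-strict linear inequalities, i.e. closed, possibly unbounded or degenerate, intervals) and quasi-polynomials $g_i$ such that $g(p)=g_i(p)$ for all $p\in P_i\cap\mathbb{N}$. *)

theory Defs
  imports
    "HOL-Analysis.Polytope"
    "HOL-Computational_Algebra.Polynomial"
    "HOL-Library.Disjoint_Sets"
begin

text \<open>
  Presburger formulas with named variables. All variables, free and quantified, range over the
  natural numbers; terms are evaluated in the integers because coefficients and constants may be
  negative.
\<close>

datatype lin_term =
    Const int
  | Var nat
  | Plus lin_term lin_term
  | Scale int lin_term

datatype presburger =
    Equal lin_term lin_term
  | LessEq lin_term lin_term
  | Neg presburger
  | Conj presburger presburger
  | Disj presburger presburger
  | Exists nat presburger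
  | Forall nat presburger

primrec lin_value :: "(nat \<Rightarrow> nat) \<Rightarrow> lin_term \<Rightarrow> int" where
  "lin_value v (Const k) = k"
| "lin_value v (Var i) = int (v i)"
| "lin_value v (Plus s t) = lin_value v s + lin_value v t"
| "lin_value v (Scale k t) = k * lin_value v t"

primrec satisfies :: "(nat \<Rightarrow> nat) \<Rightarrow> presburger \<Rightarrow> bool" where
  "satisfies v (Equal s t) \<longleftrightarrow> lin_value v s = lin_value v t"
| "satisfies v (LessEq s t) \<longleftrightarrow> lin_value v s \<le> lin_value v t"
| "satisfies v (Neg F) \<longleftrightarrow> \<not> satisfies v F"
| "satisfies v (Conj F G) \<longleftrightarrow> satisfies v F \<and> satisfies v G"
| "satisfies v (Disj F G) \<longleftrightarrow> satisfies v F \<or> satisfies v G"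
| "satisfies v (Exists i F) \<longleftrightarrow> (\<exists>n. satisfies (v(i := n)) F)"
| "satisfies v (Forall i F) \<longleftrightarrow> (\<forall>n. satisfies (v(i := n)) F)"

primrec lin_vars :: "lin_term \<Rightarrow> nat set" where
  "lin_vars (Const k) = {}"
| "lin_vars (Var i) = {i}"
| "lin_vars (Plus s t) = lin_vars s \<union> lin_vars t"
| "lin_vars (Scale k t) = lin_vars t"

primrec free_vars :: "presburger \<Rightarrow> nat set" where
  "free_vars (Equal s t) = lin_vars s \<union> lin_vars t"
| "free_vars (LessEq s t) = lin_vars s \<union> lin_vars t"
| "free_vars (Neg F) = free_vars F"
| "free_vars (Conj F G) = free_vars F \<union> free_vars G"
| "free_vars (Disj F G) = free_vars F \<union> free_vars G"
| "free_vars (Exists i F) = free_vars F - {i}"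
| "free_vars (Forall i F) = free_vars F - {i}"

text \<open>
  Variable 0 is the parameter \<open>p\<close> and variables \<open>1, \<dots>, d\<close> are the counted variables, so that the
  list \<open>p # c\<close> is the assignment. The values of \<open>(!)\<close> outside the list do not matter when
  \<open>free_vars F \<subseteq> {0..d}\<close>.
\<close>

definition solutions :: "nat \<Rightarrow> presburger \<Rightarrow> nat \<Rightarrow> nat list set" where
  "solutions d F p = {c. length c = d \<and> satisfies ((!) (p # c)) F}"

definition presburger_counting_function :: "(nat \<Rightarrow> rat) \<Rightarrow> bool" where
  "presburger_counting_function g \<longleftrightarrow>
    (\<exists>d F. free_vars F \<subseteq> {0..d} \<and>
       (\<forall>p. finite (solutions d F p)) \<and>
       (\<forall>p. g p = of_nat (card (solutions d F p))))"

text \<open>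
  The coset of \<open>p\<close> modulo the lattice \<open>m\<int>\<close> is represented by the residue \<open>p mod m\<close>; only the
  values \<open>q 0, \<dots>, q (m - 1)\<close> are used.
\<close>

definition quasi_polynomial :: "(nat \<Rightarrow> rat) \<Rightarrow> bool" where
  "quasi_polynomial g \<longleftrightarrow>
    (\<exists>m::nat. m \<ge> 1 \<and> (\<exists>q :: nat \<Rightarrow> rat poly. \<forall>p. g p = poly (q (p mod m)) (of_nat p)))"

text \<open>
  The members of \<open>\<C>\<close> are the sets \<open>P\<^sub>i \<inter> \<nat>\<close>. The library's \<^const>\<open>partition_on\<close> excludes empty
  parts, which could be dropped from any partition anyway.
\<close>

definition piecewise_quasi_polynomial :: "(nat \<Rightarrow> rat) \<Rightarrow> bool" where
  "piecewise_quasi_polynomial g \<longleftrightarrow>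
    (\<exists>\<C>. finite \<C> \<and> partition_on (UNIV :: nat set) \<C> \<and>
       (\<forall>A\<in>\<C>. (\<exists>P :: real set. polyhedron P \<and> A = {p. real p \<in> P}) \<and>
          (\<exists>h. quasi_polynomial h \<and> (\<forall>p\<in>A. g p = h p))))"

lemma lin_value_cong:
  "(\<And>i. i \<in> lin_vars t \<Longrightarrow> v i = w i) \<Longrightarrow> lin_value v t = lin_value w t"
  by (induction t) auto

lemma satisfies_cong:
  "(\<And>i. i \<in> free_vars F \<Longrightarrow> v i = w i) \<Longrightarrow> satisfies v F \<longleftrightarrow> satisfies w F"
proof (induction F arbitrary: v w)
  case (Equal s t)
  then show ?case using lin_value_cong[of s v w] lin_value_cong[of t v w] by simp
next
  case (LessEq s t)
  then show ?case using lin_value_cong[of s v w] lin_value_cong[of t v w] by simp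
next
  case (Neg F)
  then show ?case by (metis free_vars.simps(3) satisfies.simps(3))
next
  case (Conj F G)
  then show ?case by (metis UnCI free_vars.simps(4) satisfies.simps(4))
next
  case (Disj F G)
  then show ?case by (metis UnCI free_vars.simps(5) satisfies.simps(5))
next
  case (Exists i F)
  have "satisfies (v(i := n)) F \<longleftrightarrow> satisfies (w(i := n)) F" for n
    using Exists.prems by (intro Exists.IH) auto
  then show ?case by simp
next
  case (Forall i F)
  have "satisfies (v(i := n)) F \<longleftrightarrow> satisfies (w(i := n)) F" for n
    using Forall.prems by (intro Forall.IH) auto
  then show ?case by simp
qed

end

theory Submission
  imports Defs
begin

text \<open>
  A partition of \<open>\<nat>\<close> into finitely many pieces cut out by intervals has a piece that contains all
  large \<open>p\<close>, so \<open>g\<close> agrees with a quasi-polynomial from some point on. Along each residue class,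
  \<open>g\<close> is therefore eventually an integer-valued polynomial \<open>u\<close> with nonnegative values.

  Such a \<open>u\<close> has a Newton expansion \<open>u (K + k) = (\<Sum>i. \<Delta>\<^sup>i u(K) * (k choose i))\<close> around every
  \<open>K\<close>. Its coefficients are integers, but they may be negative when \<open>K\<close> is small. The
  point is that they are all nonnegative once \<open>K\<close> is large (\<open>newton_expansion_nonneg\<close>): the
  differences of \<open>u\<close> are again polynomial, hence have a constant sign eventually, and an eventually
  negative difference would drive \<open>u\<close> below zero.

  So \<open>g\<close> is a finite sum of functions that are supported at a single \<open>p\<close> and of functions that
  equal \<open>k choose i\<close> at \<open>p = a + m * k\<close> and vanish off this progression. The latter count
  the tuples with \<open>p = a + m * k\<close> and \<open>k > c\<^sub>1 > \<dots> > c\<^sub>i\<close>, where \<open>k\<close> itself is counted but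
  determined by \<open>p\<close>; and counting functions are closed under addition, because a further counted
  variable can tag the two summands.
\<close>

section \<open>Closure of counting functions under sums\<close>

definition tagged :: "nat \<Rightarrow> nat \<Rightarrow> presburger \<Rightarrow> presburger" where
  "tagged d t F = Conj F (Equal (Var (Suc d)) (Const (int t)))"

text \<open>
  A fresh last variable with a prescribed value leaves the count unchanged. The value \<open>0\<close> serves to
  pad a formula with dummy variables, two different values make two solution sets disjoint.
\<close>

lemma solutions_tagged:
  assumes "free_vars F \<subseteq> {0..d}"
  shows "solutions (Suc d) (tagged d t F) p = (\<lambda>c. c @ [t]) ` solutions d F p"
proof -
  have snoc: "satisfies ((!) (p # (c @ [x]))) F \<longleftrightarrow> satisfies ((!) (p # c)) F"
    if "length c = d" for c x
  proof (rule satisfies_cong)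
    fix i assume "i \<in> free_vars F"
    then have "i \<le> d" using assms by auto
    then show "(p # (c @ [x])) ! i = (p # c) ! i"
      using that by (metis append_Cons le_imp_less_Suc length_Cons nth_append_left)
  qed
  show ?thesis
  proof (intro equalityI subsetI)
    fix c' assume c': "c' \<in> solutions (Suc d) (tagged d t F) p"
    then have "length c' = Suc d" by (simp add: solutions_def)
    then obtain c x where c: "c' = c @ [x]" "length c = d"
      by (metis length_Suc_conv_rev)
    with c' snoc[OF c(2), of x] show "c' \<in> (\<lambda>c. c @ [t]) ` solutions d F p"
      by (auto simp: solutions_def tagged_def)
  next
    fix c' assume "c' \<in> (\<lambda>c. c @ [t]) ` solutions d F p"
    then show "c' \<in> solutions (Suc d) (tagged d t F) p"
      using snoc by (auto simp: solutions_def tagged_def)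
  qed
qed

lemma finite_solutions_tagged:
  "free_vars F \<subseteq> {0..d} \<Longrightarrow> finite (solutions d F p) \<Longrightarrow>
    finite (solutions (Suc d) (tagged d t F) p)"
  by (simp add: solutions_tagged)

lemma card_solutions_tagged:
  "free_vars F \<subseteq> {0..d} \<Longrightarrow>
    card (solutions (Suc d) (tagged d t F) p) = card (solutions d F p)"
  by (simp add: solutions_tagged card_image inj_on_def)

lemma free_vars_tagged: "free_vars F \<subseteq> {0..d} \<Longrightarrow> free_vars (tagged d t F) \<subseteq> {0..Suc d}"
  by (auto simp: tagged_def)

lemma solutions_Disj: "solutions d (Disj F G) p = solutions d F p \<union> solutions d G p"
  by (auto simp: solutions_def)

definition counts :: "nat \<Rightarrow> presburger \<Rightarrow> (nat \<Rightarrow> rat) \<Rightarrow> bool" where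
  "counts d F g \<longleftrightarrow> free_vars F \<subseteq> {0..d} \<and>
     (\<forall>p. finite (solutions d F p) \<and> g p = of_nat (card (solutions d F p)))"

lemma presburger_counting_function_iff:
  "presburger_counting_function g \<longleftrightarrow> (\<exists>d F. counts d F g)"
  by (simp add: presburger_counting_function_def counts_def all_conj_distrib)

lemma counts_tagged: "counts d F g \<Longrightarrow> counts (Suc d) (tagged d t F) g"
  by (simp add: counts_def card_solutions_tagged finite_solutions_tagged free_vars_tagged)

lemma counts_pad:
  assumes "counts d F g" and "d \<le> e"
  shows "\<exists>G. counts e G g"
  using assms(2,1) by (induction e rule: dec_induct) (auto intro: counts_tagged)

lemma presburger_counting_function_add:
  assumes "presburger_counting_function f" and "presburger_counting_function g"
  shows "presburger_counting_function (\<lambda>p. f p + g p)"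
proof -
  obtain d\<^sub>1 F\<^sub>1 d\<^sub>2 F\<^sub>2 where "counts d\<^sub>1 F\<^sub>1 f" "counts d\<^sub>2 F\<^sub>2 g"
    using assms unfolding presburger_counting_function_iff by blast
  then obtain d F G where F: "counts d F f" and G: "counts d G g"
    using counts_pad max.cobounded1 max.cobounded2 by meson
  let ?H = "Disj (tagged d 0 F) (tagged d 1 G)"
  have "solutions (Suc d) (tagged d 0 F) p \<inter> solutions (Suc d) (tagged d 1 G) p = {}" for p
    by (auto simp: solutions_def tagged_def)
  then have "counts (Suc d) ?H (\<lambda>p. f p + g p)"
    using counts_tagged[OF F, of 0] counts_tagged[OF G, of 1]
    by (auto simp: counts_def solutions_Disj card_Un_disjoint)
  then show ?thesis
    unfolding presburger_counting_function_iff by blast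
qed

lemma presburger_counting_function_zero: "presburger_counting_function (\<lambda>p. 0)"
proof -
  have "counts 0 (Equal (Const 0) (Const 1)) (\<lambda>p. 0)"
    by (simp add: counts_def solutions_def)
  then show ?thesis
    unfolding presburger_counting_function_iff by blast
qed

lemma presburger_counting_function_sum:
  assumes "\<And>i. i \<in> I \<Longrightarrow> presburger_counting_function (f i)"
  shows "presburger_counting_function (\<lambda>p. \<Sum>i\<in>I. f i p)"
  using assms
  by (induction I rule: infinite_finite_induct)
    (simp_all add: presburger_counting_function_zero presburger_counting_function_add)

lemma presburger_counting_function_mult_nat:
  assumes "presburger_counting_function f"
  shows "presburger_counting_function (\<lambda>p. of_nat n * f p)"
  using presburger_counting_function_sum[of "{..<n}" "\<lambda>_. f"] assms by simp

section \<open>Points and binomial coefficients along a progression\<close>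

lemma presburger_counting_function_point:
  "presburger_counting_function (\<lambda>p. of_bool (p = a))"
proof -
  have "solutions 0 (Equal (Var 0) (Const (int a))) p = (if p = a then {[]} else {})" for p
    by (auto simp: solutions_def)
  then have "counts 0 (Equal (Var 0) (Const (int a))) (\<lambda>p. of_bool (p = a))"
    by (simp add: counts_def)
  then show ?thesis
    unfolding presburger_counting_function_iff by blast
qed

definition descents :: "nat \<Rightarrow> nat \<Rightarrow> nat list set" where
  "descents k i = {c. length c = i \<and> sorted_wrt (>) (k # c)}"

text \<open>
  A descending list below \<open>k\<close> is an \<open>i\<close>-element subset of \<open>{..<k}\<close>. Splitting off its
  greatest element gives the recursion that the binomial coefficients satisfy by the hockey-stick
  identity.
\<close>

lemma card_descents: "finite (descents k i) \<and> card (descents k i) = k choose i"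
proof (induction i arbitrary: k)
  case 0
  have "descents k 0 = {[]}" by (auto simp: descents_def)
  then show ?case by simp
next
  case (Suc i)
  have split: "descents k (Suc i) = (\<Union>j<k. (#) j ` descents j i)"
  proof (intro equalityI subsetI)
    fix c assume "c \<in> descents k (Suc i)"
    then show "c \<in> (\<Union>j<k. (#) j ` descents j i)"
      by (cases c) (auto simp: descents_def sorted_wrt2 simp del: sorted_wrt.simps(2))
  next
    fix c assume "c \<in> (\<Union>j<k. (#) j ` descents j i)"
    then show "c \<in> descents k (Suc i)"
      by (auto simp: descents_def sorted_wrt2 simp del: sorted_wrt.simps(2))
  qed
  have "card (descents k (Suc i)) = (\<Sum>j<k. card ((#) j ` descents j i))"
    unfolding split by (rule card_UN_disjoint) (auto simp: Suc)
  also have "\<dots> = (\<Sum>j<k. j choose i)"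
    by (simp add: card_image Suc)
  also have "\<dots> = k choose Suc i"
    by (induction k) auto
  finally show ?case
    by (simp add: split Suc)
qed

text \<open>
  Variable \<open>1\<close> holds the position \<open>k\<close> in the progression. It is counted rather than bound by an
  existential quantifier, which does not change the count because \<open>p\<close> determines \<open>k\<close> when
  \<open>m > 0\<close>; the later variables hold the descending list below it.
\<close>

primrec descents_formula :: "nat \<Rightarrow> nat \<Rightarrow> nat \<Rightarrow> presburger" where
  "descents_formula a m 0 = Equal (Var 0) (Plus (Const (int a)) (Scale (int m) (Var 1)))"
| "descents_formula a m (Suc i) = Conj (descents_formula a m i)
     (LessEq (Plus (Var (Suc (Suc i))) (Const 1)) (Var (Suc i)))"

lemma free_vars_descents_formula: "free_vars (descents_formula a m i) \<subseteq> {0..Suc i}"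
  by (induction i) auto

lemma satisfies_descents_formula:
  "satisfies v (descents_formula a m i) \<longleftrightarrow>
    v 0 = a + m * v 1 \<and> (\<forall>j<i. v (Suc (Suc j)) < v (Suc j))"
proof (induction i)
  case 0
  have "int (v 0) = int a + int m * int (v 1) \<longleftrightarrow> v 0 = a + m * v 1"
    by (metis of_nat_add of_nat_eq_iff of_nat_mult)
  then show ?case by simp
next
  case (Suc i)
  then show ?case by (auto simp: less_Suc_eq)
qed

lemma solutions_descents_formula:
  "solutions (Suc i) (descents_formula a m i) p = (\<Union>k\<in>{k. p = a + m * k}. (#) k ` descents k i)"
proof -
  have "c \<in> solutions (Suc i) (descents_formula a m i) p \<longleftrightarrow>
      (\<exists>k cs. c = k # cs \<and> p = a + m * k \<and> cs \<in> descents k i)" for c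
    by (cases c)
      (auto simp: solutions_def satisfies_descents_formula descents_def
        sorted_wrt_iff_nth_Suc_transp simp del: sorted_wrt.simps)
  then show ?thesis by blast
qed

lemma presburger_counting_function_choose:
  assumes "m \<ge> 1"
  shows "presburger_counting_function
    (\<lambda>p. if a \<le> p \<and> m dvd p - a then of_nat ((p - a) div m choose i) else 0)"
proof -
  let ?F = "descents_formula a m i"
  have "{k. p = a + m * k} = (if a \<le> p \<and> m dvd p - a then {(p - a) div m} else {})" for p
    using assms by auto
  then have "solutions (Suc i) ?F p =
      (if a \<le> p \<and> m dvd p - a then (#) ((p - a) div m) ` descents ((p - a) div m) i else {})" for p
    by (simp add: solutions_descents_formula)
  then have "counts (Suc i) ?F
      (\<lambda>p. if a \<le> p \<and> m dvd p - a then of_nat ((p - a) div m choose i) else 0)"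
    using free_vars_descents_formula[of a m i] by (simp add: counts_def card_image card_descents)
  then show ?thesis
    unfolding presburger_counting_function_iff by blast
qed

text \<open>
  The residue of \<open>p\<close> is taken relative to the starting point \<open>M\<close>, so that all progressions
  \<open>M + s + m * k\<close> with \<open>s < m\<close> together cover \<open>{M..}\<close> exactly once.
\<close>

lemma presburger_counting_function_if_choose_sums:
  fixes f :: "nat \<Rightarrow> nat"
  assumes m: "m \<ge> 1"
    and f: "\<And>s k. s < m \<Longrightarrow> f (M + s + m * k) = (\<Sum>i<n s. b s i * (k choose i))"
  shows "presburger_counting_function (\<lambda>p. of_nat (f p))"
proof -
  let ?C = "\<lambda>s i p. if M + s \<le> p \<and> m dvd p - (M + s)
    then of_nat ((p - (M + s)) div m choose i) else (0::rat)"
  have small: "of_nat (f p) = (\<Sum>a<M. of_nat (f a) * of_bool (p = a))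
      + (\<Sum>s<m. \<Sum>i<n s. of_nat (b s i) * ?C s i p)" if "p < M" for p
    using that by (simp add: if_distrib sum.delta' of_bool_def cong: if_cong)
  have large: "of_nat (f p) = (\<Sum>a<M. of_nat (f a) * of_bool (p = a))
      + (\<Sum>s<m. \<Sum>i<n s. of_nat (b s i) * ?C s i p)" if "p \<ge> M" for p
  proof -
    define r where "r = (p - M) mod m"
    define k where "k = (p - M) div m"
    have r: "r < m" using m by (simp add: r_def)
    have p: "p = M + r + m * k"
      using that by (simp add: r_def k_def)
    have "?C s i p = (if s = r then of_nat (k choose i) else 0)" if "s < m" for s i
    proof (cases "s = r")
      case True
      then show ?thesis using m by (simp add: p)
    next
      case False
      have "\<not> (M + s \<le> p \<and> m dvd p - (M + s))"
      proof
        assume *: "M + s \<le> p \<and> m dvd p - (M + s)"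
        then obtain l where "p - (M + s) = m * l" by blast
        with * have "p - M = s + m * l" by simp
        with \<open>s < m\<close> have "r = s" by (simp add: r_def)
        with False show False by simp
      qed
      with False show ?thesis by (simp only: if_False)
    qed
    then have "(\<Sum>s<m. \<Sum>i<n s. of_nat (b s i) * ?C s i p) =
        (\<Sum>s<m. if s = r then \<Sum>i<n s. of_nat (b s i) * of_nat (k choose i) else 0)"
      by (intro sum.cong) auto
    also have "\<dots> = of_nat (f p)"
      using r f[OF r, of k] by (simp add: p)
    finally show ?thesis
      using that by simp
  qed
  have eq: "of_nat (f p) = (\<Sum>a<M. of_nat (f a) * of_bool (p = a))
      + (\<Sum>s<m. \<Sum>i<n s. of_nat (b s i) * ?C s i p)" for p
    by (cases "p < M") (erule small, rule large, simp)
  have "presburger_counting_function (\<lambda>p. (\<Sum>a<M. of_nat (f a) * of_bool (p = a))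
      + (\<Sum>s<m. \<Sum>i<n s. of_nat (b s i) * ?C s i p))"
    using m
    by (intro presburger_counting_function_add presburger_counting_function_sum
        presburger_counting_function_mult_nat presburger_counting_function_point
        presburger_counting_function_choose)
  then show ?thesis
    unfolding eq[symmetric] .
qed

section \<open>Newton expansions with nonnegative coefficients\<close>

definition fdiff :: "(nat \<Rightarrow> int) \<Rightarrow> nat \<Rightarrow> int" where
  "fdiff u k = u (Suc k) - u k"

lemma fdiff_telescope: "u (K + k) = u K + (\<Sum>j<k. fdiff u (K + j))"
  by (induction k) (auto simp: fdiff_def)

text \<open>
  Only the behaviour of polynomials under differences matters from here on: they are annihilated by
  an iterated difference. The sequence \<open>u\<close> is taken in \<open>int\<close>, although the coefficients of \<open>f\<close> are
  rational, because the sign arguments below need differences that are at least \<open>1\<close> in absolute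
  value unless they vanish.
\<close>

lemma fdiff_funpow_poly:
  fixes f :: "rat poly"
  assumes "\<And>k. of_int (u k) = poly f (of_nat k)" and "f = 0 \<or> degree f < n"
  shows "(fdiff ^^ n) u = (\<lambda>_. 0)"
  using assms
proof (induction n arbitrary: u f)
  case 0
  then show ?case by auto
next
  case (Suc n)
  define h where "h = pcompose f [:1, 1:] - f"
  have "of_int (fdiff u k) = poly h (of_nat k)" for k
    using Suc.prems(1)[of k] Suc.prems(1)[of "Suc k"]
    by (simp add: fdiff_def h_def poly_pcompose add.commute)
  moreover have "h = 0 \<or> degree h < n"
  proof -
    \<comment> \<open>The substitution \<open>x + 1\<close> keeps degree and leading coefficient, which cancels in \<open>h\<close>.\<close>
    have deg: "degree (pcompose f [:1, 1:]) = degree f"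
      by (simp add: degree_pcompose)
    have "coeff (pcompose f [:1, 1:]) (degree f) = lead_coeff f"
      using lead_coeff_comp[of "[:1, 1:]" f] deg by simp
    then have "coeff h (degree f) = 0"
      by (simp add: h_def)
    moreover have "degree h \<le> degree f"
      unfolding h_def using degree_diff_le[of "pcompose f [:1, 1:]" "degree f" f] deg by simp
    ultimately have "h = 0 \<or> degree h < degree f"
      using eq_zero_or_degree_less by blast
    then show ?thesis
      using Suc.prems(2) by (auto simp: h_def)
  qed
  ultimately have "(fdiff ^^ n) (fdiff u) = (\<lambda>_. 0)"
    by (rule Suc.IH)
  then show ?case
    by (simp add: funpow_Suc_right del: funpow.simps)
qed

text \<open>
  A sequence whose differences have a constant sign eventually is eventually monotone, and a monotone
  sequence changes its sign at most once.
\<close>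

lemma eventually_sign:
  assumes "(fdiff ^^ n) u = (\<lambda>_. 0)"
  shows "(\<forall>\<^sub>F k in sequentially. u k \<ge> 0) \<or> (\<forall>\<^sub>F k in sequentially. u k < 0)"
  using assms
proof (induction n arbitrary: u)
  case 0
  then show ?case by simp
next
  case (Suc n)
  then have "(fdiff ^^ n) (fdiff u) = (\<lambda>_. 0)"
    by (simp add: funpow_Suc_right del: funpow.simps)
  then consider "\<forall>\<^sub>F k in sequentially. fdiff u k \<ge> 0" | "\<forall>\<^sub>F k in sequentially. fdiff u k < 0"
    using Suc.IH by blast
  then show ?case
  proof cases
    case 1
    then obtain K where K: "fdiff u k \<ge> 0" if "k \<ge> K" for k
      by (auto simp: eventually_sequentially)
    have mono: "u l \<ge> u k" if "k \<ge> K" "l \<ge> k" for k l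
      using fdiff_telescope[of u k "l - k"] K that by (simp add: sum_nonneg)
    show ?thesis
    proof (cases "\<exists>k\<ge>K. u k \<ge> 0")
      case True
      then show ?thesis
        unfolding eventually_sequentially using mono order.trans by blast
    next
      case False
      then show ?thesis
        unfolding eventually_sequentially by (metis not_less)
    qed
  next
    case 2
    then obtain K where K: "fdiff u k < 0" if "k \<ge> K" for k
      by (auto simp: eventually_sequentially)
    have mono: "u l \<le> u k" if "k \<ge> K" "l \<ge> k" for k l
    proof -
      have "(\<Sum>j<l - k. fdiff u (k + j)) \<le> 0"
        using K that by (intro sum_nonpos) (simp add: less_imp_le)
      then show ?thesis
        using fdiff_telescope[of u k "l - k"] that by simp
    qed
    show ?thesis
    proof (cases "\<exists>k\<ge>K. u k < 0")
      case True
      then show ?thesis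
        unfolding eventually_sequentially using mono le_less_trans by blast
    next
      case False
      then show ?thesis
        unfolding eventually_sequentially by (metis not_less)
    qed
  qed
qed

text \<open>
  Otherwise the differences are eventually negative. Being integers, they are then at most \<open>-1\<close>,
  and after \<open>u K + 1\<close> further steps \<open>u\<close> has dropped below zero.
\<close>

lemma eventually_fdiff_nonneg:
  assumes "(fdiff ^^ Suc n) u = (\<lambda>_. 0)" and "\<forall>\<^sub>F k in sequentially. u k \<ge> 0"
  shows "\<forall>\<^sub>F k in sequentially. fdiff u k \<ge> 0"
proof (rule ccontr)
  assume contr: "\<not> ?thesis"
  have "(fdiff ^^ n) (fdiff u) = (\<lambda>_. 0)"
    using assms(1) by (simp add: funpow_Suc_right del: funpow.simps)
  with contr have "\<forall>\<^sub>F k in sequentially. fdiff u k < 0"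
    using eventually_sign by blast
  with assms(2) have "\<forall>\<^sub>F k in sequentially. u k \<ge> 0 \<and> fdiff u k < 0"
    by (rule eventually_conj)
  then obtain K where K: "u k \<ge> 0" "fdiff u k < 0" if "k \<ge> K" for k
    by (auto simp: eventually_sequentially)
  let ?k = "Suc (nat (u K))"
  have "(\<Sum>j<?k. fdiff u (K + j)) \<le> (\<Sum>j<?k. - 1)"
    using K(2)[OF le_add1] by (intro sum_mono) (metis zle_diff1_eq diff_0)
  then have "u (K + ?k) \<le> u K - int ?k"
    using fdiff_telescope[of u K ?k] by simp
  then have "u (K + ?k) < 0"
    using K(1)[of K] by simp
  with K(1)[of "K + ?k"] show False by simp
qed

lemma newton_expansion_nonneg:
  assumes "(fdiff ^^ n) u = (\<lambda>_. 0)" and "\<forall>\<^sub>F k in sequentially. u k \<ge> 0"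
  shows "\<forall>\<^sub>F K in sequentially. \<exists>b :: nat \<Rightarrow> nat.
    \<forall>k. u (K + k) = int (\<Sum>i<n. b i * (k choose i))"
  using assms
proof (induction n arbitrary: u)
  case 0
  then show ?case by simp
next
  case (Suc n)
  have "(fdiff ^^ n) (fdiff u) = (\<lambda>_. 0)"
    using Suc.prems(1) by (simp add: funpow_Suc_right del: funpow.simps)
  moreover have "\<forall>\<^sub>F k in sequentially. fdiff u k \<ge> 0"
    using Suc.prems by (rule eventually_fdiff_nonneg)
  ultimately have "\<forall>\<^sub>F K in sequentially. \<exists>b :: nat \<Rightarrow> nat.
      \<forall>k. fdiff u (K + k) = int (\<Sum>i<n. b i * (k choose i))"
    by (rule Suc.IH)
  with Suc.prems(2) show ?case
  proof eventually_elim
    case (elim K)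
    then obtain b :: "nat \<Rightarrow> nat"
      where b: "fdiff u (K + k) = int (\<Sum>i<n. b i * (k choose i))" for k
      by blast
    \<comment> \<open>Summation raises the lower index of each binomial coefficient by one.\<close>
    have hockey: "(\<Sum>j<k. j choose i) = k choose Suc i" for i k
      by (induction k) auto
    have "u (K + k) = int (\<Sum>i<Suc n. case_nat (nat (u K)) b i * (k choose i))" for k
    proof -
      have "u (K + k) = u K + int (\<Sum>j<k. \<Sum>i<n. b i * (j choose i))"
        by (subst fdiff_telescope) (simp add: b)
      also have "(\<Sum>j<k. \<Sum>i<n. b i * (j choose i)) = (\<Sum>i<n. b i * (k choose Suc i))"
        by (subst sum.swap) (simp add: hockey flip: sum_distrib_left)
      finally show ?thesis
        using elim(1) by (simp add: sum.lessThan_Suc_shift del: sum.lessThan_Suc)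
    qed
    then show ?case by blast
  qed
qed

section \<open>Eventually quasi-polynomial functions\<close>

text \<open>
  One of the finitely many parts is infinite. As the trace of a convex set it contains, with any of
  its elements, everything above.
\<close>

lemma piecewise_quasi_polynomial_eventually:
  assumes "piecewise_quasi_polynomial g"
  obtains h N where "quasi_polynomial h" and "\<forall>p\<ge>N. g p = h p"
proof -
  obtain \<C> where fin: "finite \<C>" and part: "partition_on (UNIV :: nat set) \<C>"
    and \<C>: "\<forall>A\<in>\<C>. (\<exists>P :: real set. polyhedron P \<and> A = {p. real p \<in> P}) \<and>
          (\<exists>h. quasi_polynomial h \<and> (\<forall>p\<in>A. g p = h p))"
    using assms unfolding piecewise_quasi_polynomial_def by blast
  have "infinite (\<Union>\<C>)"
    using part by (simp add: partition_on_def)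
  then obtain A where A: "A \<in> \<C>" "infinite A"
    using fin by blast
  obtain P h where P: "polyhedron P" "A = {p. real p \<in> P}"
    and h: "quasi_polynomial h" "\<forall>p\<in>A. g p = h p"
    using bspec[OF \<C> A(1)] by blast
  obtain N where N: "N \<in> A"
    using A(2) by fastforce
  have "p \<in> A" if "p \<ge> N" for p
  proof -
    obtain l where l: "l \<in> A" "l \<ge> p"
      using A(2) infinite_nat_iff_unbounded_le by blast
    have "real N \<in> P" "real l \<in> P"
      using N l(1) unfolding P(2) by simp_all
    moreover have "is_interval P"
      using P(1) by (simp add: polyhedron_imp_convex is_interval_convex_1)
    ultimately have "real p \<in> P"
      using that l(2) mem_is_interval_1_I[of P "real N" "real l" "real p"] by simp
    then show ?thesis
      by (simp add: P(2))
  qed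
  with h that[of h N] show thesis by blast
qed

theorem proposition1p12:
  fixes g :: "nat \<Rightarrow> rat"
  assumes "piecewise_quasi_polynomial g"
    and "range g \<subseteq> \<nat>"
  shows "presburger_counting_function g"
proof -
  obtain h N where h: "quasi_polynomial h" and gh: "\<forall>p\<ge>N. g p = h p"
    using assms(1) by (rule piecewise_quasi_polynomial_eventually)
  obtain m q where m: "m \<ge> 1" and q: "\<And>p. h p = poly (q (p mod m)) (of_nat p)"
    using h unfolding quasi_polynomial_def by blast
  have "\<forall>p. \<exists>n::nat. g p = of_nat n"
    using assms(2) by (auto simp: Nats_def)
  then obtain f :: "nat \<Rightarrow> nat" where f: "\<And>p. g p = of_nat (f p)"
    by metis
  have "\<forall>\<^sub>F K in sequentially. \<exists>n. \<exists>b :: nat \<Rightarrow> nat.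
      \<forall>k. f (m * (N + (K + k)) + s) = (\<Sum>i<n. b i * (k choose i))" if "s < m" for s
  proof -
    \<comment> \<open>Starting at \<open>m * N \<ge> N\<close> makes the sequence polynomial, hence integer-valued, at every \<open>k\<close>.\<close>
    define u where "u k = int (f (m * (N + k) + s))" for k
    define P where "P = pcompose (q s) [:of_nat (m * N + s), of_nat m:]"
    have "of_int (u k) = poly P (of_nat k)" for k
    proof -
      let ?p = "m * (N + k) + s"
      have "?p \<ge> 1 * N"
        using mult_le_mono[OF m, of N "N + k"] by simp
      then have "of_int (u k) = poly (q (?p mod m)) (of_nat ?p)"
        using gh[rule_format, of ?p] f[of ?p] q[of ?p] by (simp add: u_def)
      also have "?p mod m = s"
        using that by simp
      finally show ?thesis
        by (simp add: P_def poly_pcompose algebra_simps)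
    qed
    then have "(fdiff ^^ Suc (degree P)) u = (\<lambda>_. 0)"
      by (rule fdiff_funpow_poly) simp
    moreover have "\<forall>\<^sub>F k in sequentially. u k \<ge> 0"
      by (simp add: u_def)
    ultimately have "\<forall>\<^sub>F K in sequentially. \<exists>b :: nat \<Rightarrow> nat.
        \<forall>k. u (K + k) = int (\<Sum>i<Suc (degree P). b i * (k choose i))"
      by (rule newton_expansion_nonneg)
    then show ?thesis
      by (rule eventually_mono) (unfold u_def of_nat_eq_iff, blast)
  qed
  then have "\<forall>\<^sub>F K in sequentially. \<forall>s\<in>{..<m}. \<exists>n. \<exists>b :: nat \<Rightarrow> nat.
      \<forall>k. f (m * (N + (K + k)) + s) = (\<Sum>i<n. b i * (k choose i))"
    by (intro eventually_ball_finite) auto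
  then have "\<exists>K. \<forall>s\<in>{..<m}. \<exists>n. \<exists>b :: nat \<Rightarrow> nat.
      \<forall>k. f (m * (N + (K + k)) + s) = (\<Sum>i<n. b i * (k choose i))"
    by (rule eventually_happens'[OF sequentially_bot])
  then obtain K n b where nb: "\<forall>s\<in>{..<m}. \<forall>k.
      f (m * (N + (K + k)) + s) = (\<Sum>i<n s. b s i * (k choose i))"
    unfolding bchoice_iff by blast
  have "presburger_counting_function (\<lambda>p. of_nat (f p))"
  proof (rule presburger_counting_function_if_choose_sums[OF m])
    fix s k assume "s < m"
    moreover have "m * (N + K) + s + m * k = m * (N + (K + k)) + s"
      by (simp add: algebra_simps)
    ultimately show "f (m * (N + K) + s + m * k) = (\<Sum>i<n s. b s i * (k choose i))"
      using nb by (simp only: lessThan_iff Ball_def)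
  qed
  then show ?thesis
    unfolding f[symmetric] .
qed

end
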